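(* For any cardinal $\kappa\ge\omega$ and natural numbers $m,\ell$ with $\ell>0$, $w\chi_{\rm CF}(\beth_m(\kappa),\kappa,2\ell+1)\ge (m+1)\cdot\ell+1$.
   Context: $\beth_0(\kappa)=\kappa$, $\beth_{r+1}(\kappa)=2^{\beth_r(\kappa)}$. A weak conflict free coloring of a family $\mathcal A$ with $\rho$ colors is a function $f$ with $\operatorname{dom}(f)\subseteq\bigcup\mathcal A$, values in $\rho$, such that every $A\in\mathcal A$ has some $\zeta$ with $|A\cap f^{-1}\{\zeta\}|=1$; $w\chi_{\rm CF}(\mathcal A)$ is the least such $\rho$. A $(\lambda,\kappa,\mu)$-system is a family of $\lambda$ sets each of size $\kappa$, distinct members meeting in fewer than $\mu$ points; $w\chi_{\rm CF}(\lambda,\kappa,\mu)$ is the supremum of $w\chi_{\rm CF}(\mathcal A)$ over all $(\lambda,\kappa,\mu)$-systems. *)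

theory Defs
  imports Main "HOL-Library.Equipollence"
begin

text \<open>Cardinals are represented by sets (up to equipollence).
  Beth: \<open>is_beth m K B\<close> says that B has cardinality beth_m(|K|):
  there is a chain of sets C 0 \<approx> K, C (i+1) \<approx> Pow (C i), ending in B.\<close>

definition is_beth :: "nat \<Rightarrow> 'a set \<Rightarrow> 'b set \<Rightarrow> bool" where
  "is_beth m K B \<longleftrightarrow>
     (\<exists>C :: nat \<Rightarrow> 'b set. C 0 \<approx> K \<and> (\<forall>i<m. C (Suc i) \<approx> Pow (C i)) \<and> C m = B)"

definition is_system :: "'b set set \<Rightarrow> 'l set \<Rightarrow> 'k set \<Rightarrow> 'm set \<Rightarrow> bool" where
  "is_system \<A> L K M \<longleftrightarrow>
     \<A> \<approx> L \<and> (\<forall>A\<in>\<A>. A \<approx> K) \<and> (\<forall>A\<in>\<A>. \<forall>B\<in>\<A>. A \<noteq> B \<longrightarrow> A \<inter> B \<prec> M)"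

definition wcf_coloring :: "'b set set \<Rightarrow> 'b set \<Rightarrow> ('b \<Rightarrow> 'c) \<Rightarrow> 'c set \<Rightarrow> bool" where
  "wcf_coloring \<A> D f R \<longleftrightarrow>
     D \<subseteq> \<Union>\<A> \<and> f ` D \<subseteq> R \<and>
     (\<forall>A\<in>\<A>. \<exists>\<zeta>\<in>R. card {x \<in> A \<inter> D. f x = \<zeta>} = 1)"

definition wchi_CF_ge :: "'b set set \<Rightarrow> nat \<Rightarrow> bool" where
  "wchi_CF_ge \<A> N \<longleftrightarrow>
     (\<forall>\<rho><N. \<not> (\<exists>D (f :: 'b \<Rightarrow> nat). wcf_coloring \<A> D f {..<\<rho>}))"

end

theory Submission
  imports Defs
begin

text \<open>A set is bad for a colouring if it contains no colour exactly once; every colour can be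
  ruled out by putting two of its points into the set. With \<open>\<kappa>\<close> sets, any \<open>2 * l\<close> points can be
  prescribed in infinitely many members that are otherwise disjoint, which rules out \<open>l\<close> colours.
  Passing from \<open>\<lambda>\<close> to \<open>2 ^ \<lambda>\<close> sets rules out \<open>l\<close> more: \<open>l\<close> colours that occur \<open>\<lambda>\<close> times on
  \<open>\<lambda>\<close> old points can be doubled by \<open>\<lambda>\<close> pairwise disjoint sets of \<open>2 * l\<close> old points, and there are
  only \<open>2 ^ \<lambda>\<close> ways to choose those sets, so that each choice can be attached to its own fresh copy
  of the system on \<open>\<lambda>\<close>.\<close>

section \<open>Cardinal arithmetic for domination of sets\<close>

lemma lepoll_iff_card_of_ordLeq: "A \<lesssim> B \<longleftrightarrow> (card_of A, card_of B) \<in> ordLeq"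
  by (simp add: lepoll_def card_of_ordLeq)

text \<open>Comparability of cardinals turns strict domination into failure of the reverse
  domination, and on well-orders \<open>ordLess\<close> is the negation of the reversed
  \<open>ordLeq\<close>.\<close>

lemma lesspoll_iff_card_of_ordLess: "A \<prec> B \<longleftrightarrow> (card_of A, card_of B) \<in> ordLess"
proof -
  have "A \<lesssim> B \<or> B \<lesssim> A"
    unfolding lepoll_iff_card_of_ordLeq by (rule ordLeq_total) (rule card_of_Well_order)+
  then have "A \<prec> B \<longleftrightarrow> \<not> B \<lesssim> A"
    unfolding lesspoll_def by (metis lepoll_antisym eqpoll_imp_lepoll eqpoll_sym)
  also have "\<dots> \<longleftrightarrow> (card_of A, card_of B) \<in> ordLess"
    unfolding lepoll_iff_card_of_ordLeq
    by (rule not_ordLeq_iff_ordLess) (rule card_of_Well_order)+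
  finally show ?thesis .
qed

lemma infinite_lepoll: "infinite A \<Longrightarrow> A \<lesssim> B \<Longrightarrow> infinite B"
  by (auto simp: lepoll_def dest: inj_on_finite)

lemma times_self_lepoll: "infinite L \<Longrightarrow> L \<times> L \<lesssim> L"
  by (simp add: lepoll_iff_card_of_ordLeq card_of_Times_same_infinite ordIso_imp_ordLeq)

lemma times_lepoll_infinite: "infinite L \<Longrightarrow> A \<lesssim> L \<Longrightarrow> B \<lesssim> L \<Longrightarrow> A \<times> B \<lesssim> L"
  by (rule lepoll_trans[OF times_lepoll_mono times_self_lepoll])

lemma Plus_lepoll_infinite:
  assumes "infinite L" "A \<lesssim> L" "B \<lesssim> L"
  shows "A <+> B \<lesssim> L"
proof -
  have "L <+> L \<lesssim> L"
    using card_of_Plus_infinite1[OF assms(1) ordLeq_refl[OF card_of_Card_order]]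
    by (simp add: lepoll_iff_card_of_ordLeq ordIso_imp_ordLeq)
  then show ?thesis using assms(2,3) by (blast intro: lepoll_trans[OF sum_lepoll_mono])
qed

lemma Un_lepoll_infinite: "infinite L \<Longrightarrow> A \<lesssim> L \<Longrightarrow> B \<lesssim> L \<Longrightarrow> A \<union> B \<lesssim> L"
  using Plus_lepoll_infinite[of L A B] card_of_Un_Plus_ordLeq[of A B]
  unfolding lepoll_iff_card_of_ordLeq by (blast intro: ordLeq_transitive)

lemma finite_UN_lesspoll_infinite:
  assumes "finite T" "infinite L" "\<And>c. c \<in> T \<Longrightarrow> D c \<prec> L"
  shows "(\<Union>c\<in>T. D c) \<prec> L"
  using assms(1,3)
proof (induction T rule: finite_induct)
  case empty
  show ?case using assms(2) by (simp add: finite_lesspoll_infinite)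
next
  case (insert c T)
  then show ?case using assms(2)
    by (auto simp: lesspoll_iff_card_of_ordLess intro!: card_of_Un_ordLess_infinite)
qed

lemma Pow_lepoll_mono: "A \<lesssim> B \<Longrightarrow> Pow A \<lesssim> Pow B"
  unfolding lepoll_def
  by (metis image_Pow_mono inj_on_image_Pow)

text \<open>A nonempty set of at most \<open>n + 1\<close> points arises by inserting a point into
  one of at most \<open>n\<close> points, so each induction step costs one product with
  \<open>G\<close>, which an infinite \<open>L\<close> absorbs.\<close>

lemma bounded_subsets_lepoll:
  assumes "infinite L" "G \<lesssim> L"
  shows "{x. x \<subseteq> G \<and> finite x \<and> card x \<le> n} \<lesssim> L"
proof (induction n)
  case 0
  have "{x. x \<subseteq> G \<and> finite x \<and> card x \<le> 0} = {{}}" by auto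
  then show ?case using assms(1) by (simp add: finite_lepoll_infinite)
next
  case (Suc n)
  let ?S = "\<lambda>n. {x. x \<subseteq> G \<and> finite x \<and> card x \<le> n}"
  have "?S (Suc n) \<subseteq> {{}} \<union> (\<lambda>(a, x). insert a x) ` (G \<times> ?S n)"
  proof
    fix x assume x: "x \<in> ?S (Suc n)"
    show "x \<in> {{}} \<union> (\<lambda>(a, x). insert a x) ` (G \<times> ?S n)"
    proof (cases "x = {}")
      case False
      then obtain a where "a \<in> x" by auto
      then have "x = insert a (x - {a})" "a \<in> G" "x - {a} \<in> ?S n" using x by auto
      then show ?thesis by (metis (no_types, lifting) SigmaI UnI2 case_prod_conv imageI)
    qed auto
  qed
  moreover have "(\<lambda>(a, x). insert a x) ` (G \<times> ?S n) \<lesssim> L"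
    using times_lepoll_infinite[OF assms Suc] image_lepoll lepoll_trans by blast
  moreover have "{{}::'b set} \<lesssim> L" using assms(1) by (simp add: finite_lepoll_infinite)
  ultimately show ?case using assms(1)
    by (meson Un_lepoll_infinite lepoll_trans subset_imp_lepoll)
qed

section \<open>Counting colours and defeating colourings\<close>

lemma card_Collect_image_eq:
  "inj_on g A \<Longrightarrow> card {y \<in> g ` A. f y = c} = card {x \<in> A. f (g x) = c}"
proof -
  assume g: "inj_on g A"
  have "{y \<in> g ` A. f y = c} = g ` {x \<in> A. f (g x) = c}" by auto
  moreover have "inj_on g {x \<in> A. f (g x) = c}" using g by (rule inj_on_subset) auto
  ultimately show ?thesis by (simp add: card_image)
qed

lemma card_neq_1_if_two: "a \<in> S \<Longrightarrow> b \<in> S \<Longrightarrow> a \<noteq> b \<Longrightarrow> card S \<noteq> 1"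
  by (auto simp: card_1_singleton_iff)

text \<open>A partial colouring is modelled by a total one together with its set \<open>T\<close> of genuine
  colours; points whose value lies outside \<open>T\<close> are uncoloured.\<close>

definition defeats_colorings :: "'b set set \<Rightarrow> nat \<Rightarrow> bool" where
  "defeats_colorings \<A> n \<longleftrightarrow>
     (\<forall>(f :: 'b \<Rightarrow> nat) T. finite T \<longrightarrow> card T \<le> n \<longrightarrow>
        (\<exists>A\<in>\<A>. \<forall>c\<in>T. card {x \<in> A. f x = c} \<noteq> 1))"

lemma defeats_coloringsD:
  fixes f :: "'b \<Rightarrow> nat"
  assumes "defeats_colorings \<A> n" "finite T" "card T \<le> n"
  shows "\<exists>A\<in>\<A>. \<forall>c\<in>T. card {x \<in> A. f x = c} \<noteq> 1"
  using assms unfolding defeats_colorings_def by blast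

lemma defeats_colorings_imp_wchi_CF_ge:
  assumes "defeats_colorings \<A> n"
  shows "wchi_CF_ge \<A> (n + 1)"
  unfolding wchi_CF_ge_def
proof (intro allI impI notI)
  fix \<rho> assume "\<rho> < n + 1" and "\<exists>D (f :: 'a \<Rightarrow> nat). wcf_coloring \<A> D f {..<\<rho>}"
  then obtain D and f :: "'a \<Rightarrow> nat" where
    w: "\<forall>A\<in>\<A>. \<exists>\<zeta>\<in>{..<\<rho>}. card {x \<in> A \<inter> D. f x = \<zeta>} = 1"
    by (auto simp: wcf_coloring_def)
  \<comment> \<open>The value \<open>\<rho>\<close> lies outside \<open>{..<\<rho>}\<close> and so
    marks the uncoloured points.\<close>
  define g where "g x = (if x \<in> D then f x else \<rho>)" for x
  obtain A where A: "A \<in> \<A>" "\<forall>c\<in>{..<\<rho>}. card {x \<in> A. g x = c} \<noteq> 1"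
    using defeats_coloringsD[OF assms, of "{..<\<rho>}" g] \<open>\<rho> < n + 1\<close> by auto
  moreover have "{x \<in> A. g x = c} = {x \<in> A \<inter> D. f x = c}" if "c < \<rho>" for c
    using that by (auto simp: g_def)
  ultimately show False using w by (metis lessThan_iff)
qed

section \<open>Systems with upper bounds and their transport into a given set\<close>

text \<open>Only upper bounds are imposed on the numbers of members and points, so that
  \<open>L\<close> may be replaced by any larger set. The bound on the union is what allows the
  points to be moved into \<open>L\<close>.\<close>

definition bounded_system :: "'b set set \<Rightarrow> 'l set \<Rightarrow> 'k set \<Rightarrow> nat \<Rightarrow> bool" where
  "bounded_system \<A> L K d \<longleftrightarrow>
     \<A> \<lesssim> L \<and> \<Union>\<A> \<lesssim> L \<and> (\<forall>A\<in>\<A>. A \<approx> K) \<and>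
     (\<forall>A\<in>\<A>. \<forall>B\<in>\<A>. A \<noteq> B \<longrightarrow> A \<inter> B \<lesssim> {..<d})"

text \<open>Padding with \<open>|L|\<close> pairwise disjoint copies of \<open>K\<close> makes the
  number of members exact. Extra members do no harm, since defeating a colouring only asks for one
  bad member.\<close>

lemma bounded_system_transfer:
  fixes \<A> :: "'c set set" and L :: "'b set" and K :: "'k set"
  assumes sys: "bounded_system \<A> L K d" and "defeats_colorings \<A> n"
    and "infinite L" "K \<lesssim> L" "K \<noteq> {}"
  obtains \<B> :: "'b set set"
  where "\<B> \<approx> L" "bounded_system \<B> L K d" "defeats_colorings \<B> n"
proof -
  have "\<Union>\<A> <+> (L \<times> K) \<lesssim> L"
    using assms by (intro Plus_lepoll_infinite times_lepoll_infinite) (auto simp: bounded_system_def)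
  then obtain j where j: "inj_on j (\<Union>\<A> <+> (L \<times> K))" "j ` (\<Union>\<A> <+> (L \<times> K)) \<subseteq> L"
    by (auto simp: lepoll_def)
  \<comment> \<open>One injection makes room for everything: \<open>p\<close> embeds the given
    points, \<open>q a\<close> is the padding copy of \<open>K\<close> with index
    \<open>a\<close>.\<close>
  define p where "p = j \<circ> Inl"
  define q where "q a = (\<lambda>k. j (Inr (a, k)))" for a
  have p: "inj_on p (\<Union>\<A>)" "p ` \<Union>\<A> \<subseteq> L"
    using j by (auto simp: p_def inj_on_def image_subset_iff)
  have q: "inj_on (q a) K" "q a ` K \<subseteq> L" if "a \<in> L" for a
    using j that by (auto simp: q_def inj_on_def image_subset_iff)
  have pq: "p ` \<Union>\<A> \<inter> q a ` K = {}" if "a \<in> L" for a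
    using j(1) that by (auto simp: p_def q_def inj_on_def)
  have qq: "q a ` K \<inter> q b ` K = {}" if "a \<in> L" "b \<in> L" "a \<noteq> b" for a b
    using j(1) that by (auto simp: q_def inj_on_def)
  define \<B> where "\<B> = (\<lambda>A. p ` A) ` \<A> \<union> (\<lambda>a. q a ` K) ` L"
  have pA: "inj_on p A" if "A \<in> \<A>" for A
    using p(1) that by (meson Union_upper inj_on_subset)
  have inj: "inj_on (\<lambda>a. q a ` K) L"
  proof (rule inj_onI, rule ccontr)
    fix a b assume "a \<in> L" "b \<in> L" "q a ` K = q b ` K" "a \<noteq> b"
    then show False using qq[of a b] \<open>K \<noteq> {}\<close> by simp
  qed
  have "\<B> \<lesssim> L"
    unfolding \<B>_def using sys \<open>infinite L\<close>
    by (intro Un_lepoll_infinite) (auto simp: bounded_system_def intro: lepoll_trans[OF image_lepoll])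
  moreover have "L \<lesssim> \<B>"
    unfolding lepoll_def \<B>_def using inj by blast
  ultimately have "\<B> \<approx> L" by (rule lepoll_antisym)
  have int: "A \<inter> B \<lesssim> {..<d}" if "A \<in> \<B>" "B \<in> \<B>" "A \<noteq> B" for A B
  proof (cases "A \<inter> B = {}")
    case False
    \<comment> \<open>Padding copies are disjoint from each other and from the image of the given
      system, so distinct members that meet both come from \<open>\<A>\<close>.\<close>
    consider A' B' where "A' \<in> \<A>" "B' \<in> \<A>" "A = p ` A'" "B = p ` B'"
      | A' b where "A' \<in> \<A>" "b \<in> L" "A = p ` A'" "B = q b ` K"
      | a B' where "a \<in> L" "B' \<in> \<A>" "A = q a ` K" "B = p ` B'"
      | a b where "a \<in> L" "b \<in> L" "A = q a ` K" "B = q b ` K"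
      using \<open>A \<in> \<B>\<close> \<open>B \<in> \<B>\<close> unfolding \<B>_def by (elim UnE imageE)
    then obtain A' B' where AB: "A' \<in> \<A>" "B' \<in> \<A>" "A = p ` A'" "B = p ` B'"
    proof cases
      case 2
      then show ?thesis using pq False by blast
    next
      case 3
      then show ?thesis using pq False by blast
    next
      case 4
      then show ?thesis using qq[of a b] False \<open>A \<noteq> B\<close> by auto
    qed
    have "A \<inter> B = p ` (A' \<inter> B')"
      using AB p(1) by (metis Union_upper inj_on_image_Int)
    moreover have "A' \<inter> B' \<lesssim> {..<d}"
      using sys AB that(3) unfolding bounded_system_def by blast
    ultimately show ?thesis by (metis image_lepoll lepoll_trans)
  qed auto
  have "\<Union>\<B> \<subseteq> L"
    using p(2) q(2) unfolding \<B>_def by blast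
  then have "\<Union>\<B> \<lesssim> L" by (rule subset_imp_lepoll)
  moreover have "\<forall>A\<in>\<B>. A \<approx> K"
    using sys pA q by (auto simp: \<B>_def bounded_system_def)
  ultimately have "bounded_system \<B> L K d"
    using int \<open>\<B> \<lesssim> L\<close> by (simp add: bounded_system_def)
  moreover have "defeats_colorings \<B> n"
    unfolding defeats_colorings_def
  proof (intro allI impI)
    fix f :: "'b \<Rightarrow> nat" and T :: "nat set" assume "finite T" "card T \<le> n"
    then obtain A where A: "A \<in> \<A>" "\<forall>c\<in>T. card {x \<in> A. f (p x) = c} \<noteq> 1"
      using defeats_coloringsD[OF assms(2), of T "f \<circ> p"] by auto
    then have "\<forall>c\<in>T. card {y \<in> p ` A. f y = c} \<noteq> 1"
      unfolding card_Collect_image_eq[OF pA[OF A(1)]] by blast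
    moreover have "p ` A \<in> \<B>" using A(1) by (simp add: \<B>_def)
    ultimately show "\<exists>A\<in>\<B>. \<forall>c\<in>T. card {x \<in> A. f x = c} \<noteq> 1" by blast
  qed
  ultimately show thesis using that \<open>\<B> \<approx> L\<close> by blast
qed

section \<open>The base system on \<open>\<kappa>\<close> points\<close>

text \<open>Two points are chosen for each colour of \<open>S\<close>, and nothing else, so no
  further colour is brought in; this is where the bound \<open>2 * l\<close> on intersections
  originates.\<close>

lemma obtain_doubling_set:
  assumes "finite S" "card S \<le> l"
    and "\<And>c. c \<in> S \<Longrightarrow> \<exists>a\<in>G. \<exists>b\<in>G. a \<noteq> b \<and> f a = c \<and> f b = c"
  obtains x where "x \<subseteq> G" "finite x" "card x \<le> 2 * l" "f ` x \<subseteq> S"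
    "\<And>c. c \<in> S \<Longrightarrow> \<exists>a\<in>x. \<exists>b\<in>x. a \<noteq> b \<and> f a = c \<and> f b = c"
proof -
  obtain a b where ab: "\<And>c. c \<in> S \<Longrightarrow> a c \<in> G \<and> b c \<in> G \<and> a c \<noteq> b c \<and> f (a c) = c \<and> f (b c) = c"
    using assms(3) by metis
  have "card (a ` S \<union> b ` S) \<le> card (a ` S) + card (b ` S)" by (rule card_Un_le)
  also have "\<dots> \<le> 2 * l" using card_image_le[OF assms(1)] assms(2)
    by (metis add_mono le_trans mult_2)
  finally show thesis
    using ab assms(1) by (intro that[of "a ` S \<union> b ` S"]) auto
qed

text \<open>The members are \<open>x \<union> F (i, x)\<close> for \<open>i \<in> K\<close> and \<open>x\<close> of size at most \<open>2 * l\<close>, with pairwise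
  disjoint sets \<open>F (i, x)\<close>. All points of \<open>F (i, x)\<close> have larger second component than those of
  \<open>x\<close>, so \<open>x\<close> meets \<open>F (j, y)\<close> only if \<open>y\<close> does not meet \<open>F (i, x)\<close>.\<close>

lemma exists_system_base:
  fixes K :: "'a set"
  assumes K: "infinite K"
  shows "\<exists>\<A> :: ('a \<times> nat) set set. bounded_system \<A> K K (2 * l) \<and> defeats_colorings \<A> l"
proof -
  let ?N = "UNIV :: nat set"
  define G where "G = K \<times> ?N"
  define X where "X = {x. x \<subseteq> G \<and> finite x \<and> card x \<le> 2 * l}"
  have G: "G \<lesssim> K" unfolding G_def
    using K by (simp add: times_lepoll_infinite infinite_le_lepoll[symmetric])
  have KX: "K \<times> X \<lesssim> K"
    unfolding X_def using K G by (intro times_lepoll_infinite bounded_subsets_lepoll) auto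
  then have "(K \<times> X) \<times> K \<lesssim> K" using K by (simp add: times_lepoll_infinite)
  then obtain e where e: "inj_on e ((K \<times> X) \<times> K)" "e ` ((K \<times> X) \<times> K) \<subseteq> K"
    by (auto simp: lepoll_def)
  \<comment> \<open>\<open>insert 0\<close> provides a maximum for empty \<open>x\<close>;
    \<open>Suc\<close> puts the rank strictly above every second component in
    \<open>x\<close>.\<close>
  define rk :: "('a \<times> nat) set \<Rightarrow> nat" where "rk x = Suc (Max (insert 0 (snd ` x)))" for x
  have rk: "snd z < rk x" if "finite x" "z \<in> x" for x z
    using that by (auto simp: rk_def less_Suc_eq_le intro!: Max_ge)
  \<comment> \<open>Disjointness comes from the first components, which \<open>e\<close> keeps
    apart; the second component records the rank.\<close>
  define F where "F u = (\<lambda>k. (e (u, k), rk (snd u))) ` K" for u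
  define S where "S u = snd u \<union> F u" for u
  define \<A> where "\<A> = S ` (K \<times> X)"
  have FG: "F u \<subseteq> G" if "u \<in> K \<times> X" for u
    using e(2) that by (auto simp: F_def G_def)
  have F_disj: "F u \<inter> F v = {}" if "u \<in> K \<times> X" "v \<in> K \<times> X" "u \<noteq> v" for u v
  proof (rule ccontr)
    assume "F u \<inter> F v \<noteq> {}"
    then obtain k k' where "k \<in> K" "k' \<in> K" "e (u, k) = e (v, k')" by (auto simp: F_def)
    then have "(u, k) = (v, k')" using that by (intro inj_onD[OF e(1)]) auto
    then show False using \<open>u \<noteq> v\<close> by simp
  qed
  have F_eqpoll: "F u \<approx> K" if "u \<in> K \<times> X" for u
    unfolding F_def
  proof (intro inj_on_image_eqpoll_self inj_onI)
    fix k k' assume "k \<in> K" "k' \<in> K" "(e (u, k), rk (snd u)) = (e (u, k'), rk (snd u))"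
    then have "(u, k) = (u, k')" using that by (intro inj_onD[OF e(1)]) auto
    then show "k = k'" by simp
  qed
  have S_eqpoll: "S u \<approx> K" if "u \<in> K \<times> X" for u
  proof (rule lepoll_antisym)
    have "snd u \<lesssim> K" using that K by (auto simp: X_def intro: finite_lepoll_infinite)
    then show "S u \<lesssim> K"
      unfolding S_def using K eqpoll_imp_lepoll[OF F_eqpoll[OF that]] by (intro Un_lepoll_infinite)
    have "K \<lesssim> F u" using F_eqpoll[OF that] eqpoll_sym eqpoll_imp_lepoll by blast
    then show "K \<lesssim> S u"
      unfolding S_def by (rule lepoll_trans[OF _ subset_imp_lepoll[OF Un_upper2]])
  qed
  have small: "x \<lesssim> {..<2 * l}" if "x \<in> X" for x
    using that by (auto simp: X_def lepoll_iff_finite_card)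
  have int: "S u \<inter> S v \<lesssim> {..<2 * l}" if uv: "u \<in> K \<times> X" "v \<in> K \<times> X" "u \<noteq> v" for u v
  proof -
    \<comment> \<open>By symmetry \<open>u\<close> may be taken to have the smaller rank: then
      \<open>F v\<close> lies above all points of \<open>snd u\<close>, which leaves only
      \<open>snd v\<close> for common points.\<close>
    have *: "S u \<inter> S v \<subseteq> snd v" if "rk (snd u) \<le> rk (snd v)" "u \<in> K \<times> X" "v \<in> K \<times> X" "u \<noteq> v" for u v
    proof -
      have "snd u \<inter> F v = {}"
      proof (rule ccontr)
        assume "snd u \<inter> F v \<noteq> {}"
        then obtain k where "(e (v, k), rk (snd v)) \<in> snd u" by (auto simp: F_def)
        then show False using rk[of "snd u" "(e (v, k), rk (snd v))"] that(1,2) by (auto simp: X_def)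
      qed
      moreover have "F u \<inter> F v = {}" using F_disj that by blast
      ultimately show ?thesis unfolding S_def by blast
    qed
    have "S u \<inter> S v \<subseteq> snd v \<or> S u \<inter> S v \<subseteq> snd u"
      using *[of u v] *[of v u] uv by (metis Int_commute linear)
    moreover have "snd u \<lesssim> {..<2 * l}" "snd v \<lesssim> {..<2 * l}" using uv small by auto
    ultimately show ?thesis by (meson lepoll_trans subset_imp_lepoll)
  qed
  have "\<Union>\<A> \<subseteq> G" using FG by (auto simp: \<A>_def S_def X_def)
  then have "\<Union>\<A> \<lesssim> K" using G by (meson lepoll_trans subset_imp_lepoll)
  moreover have "\<A> \<lesssim> K" unfolding \<A>_def using KX by (meson image_lepoll lepoll_trans)
  ultimately have "bounded_system \<A> K K (2 * l)"
    using S_eqpoll int unfolding bounded_system_def \<A>_def by blast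
  moreover have "defeats_colorings \<A> l"
    unfolding defeats_colorings_def
  proof (intro allI impI)
    fix f :: "'a \<times> nat \<Rightarrow> nat" and T :: "nat set" assume T: "finite T" "card T \<le> l"
    \<comment> \<open>\<open>T2\<close> collects the colours that can be doubled. Every other colour
      of \<open>T\<close> occurs at most once on \<open>G\<close>, so these colours occupy only the
      finite set \<open>Q\<close>.\<close>
    define T2 where "T2 = {c \<in> T. \<exists>a\<in>G. \<exists>b\<in>G. a \<noteq> b \<and> f a = c \<and> f b = c}"
    have "finite T2" "card T2 \<le> l"
      using T by (auto simp: T2_def intro: le_trans[OF card_mono])
    then obtain x where x: "x \<subseteq> G" "finite x" "card x \<le> 2 * l" "f ` x \<subseteq> T2"
      and dbl: "\<And>c. c \<in> T2 \<Longrightarrow> \<exists>a\<in>x. \<exists>b\<in>x. a \<noteq> b \<and> f a = c \<and> f b = c"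
      by (rule obtain_doubling_set[of T2 l G f]) (auto simp: T2_def)
    have xX: "x \<in> X" using x by (auto simp: X_def)
    define Q where "Q = {z \<in> G. f z \<in> T - T2}"
    have "inj_on f Q" by (auto simp: Q_def T2_def inj_on_def)
    moreover have "f ` Q \<subseteq> T" by (auto simp: Q_def)
    ultimately have "finite Q" using T(1) inj_on_finite by blast
    \<comment> \<open>Infinitely many disjoint sets cannot all meet the finite set
      \<open>Q\<close>.\<close>
    have "\<exists>i\<in>K. F (i, x) \<inter> Q = {}"
    proof (rule ccontr)
      assume "\<not> ?thesis"
      then have "\<forall>i\<in>K. \<exists>z. z \<in> F (i, x) \<inter> Q" by blast
      then obtain h where h: "\<And>i. i \<in> K \<Longrightarrow> h i \<in> F (i, x) \<inter> Q" by metis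
      have "inj_on h K"
      proof (intro inj_onI, rule ccontr)
        fix i j assume ij: "i \<in> K" "j \<in> K" "h i = h j" "i \<noteq> j"
        then have "F (i, x) \<inter> F (j, x) = {}" using xX by (intro F_disj) auto
        then show False using h[OF ij(1)] h[OF ij(2)] ij(3) by auto
      qed
      moreover have "h ` K \<subseteq> Q" using h by auto
      ultimately show False using \<open>finite Q\<close> K inj_on_finite by blast
    qed
    then obtain i where i: "i \<in> K" "F (i, x) \<inter> Q = {}" by auto
    have iG: "F (i, x) \<subseteq> G" using FG[of "(i, x)"] i(1) xX by auto
    show "\<exists>A\<in>\<A>. \<forall>c\<in>T. card {z \<in> A. f z = c} \<noteq> 1"
    proof (intro bexI[of _ "S (i, x)"] ballI)
      fix c assume c: "c \<in> T"
      show "card {z \<in> S (i, x). f z = c} \<noteq> 1"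
      proof (cases "c \<in> T2")
        case True
        then obtain a b where "a \<in> x" "b \<in> x" "a \<noteq> b" "f a = c" "f b = c" using dbl by blast
        then show ?thesis by (intro card_neq_1_if_two[of a _ b]) (auto simp: S_def)
      next
        case False
        then have "{z \<in> S (i, x). f z = c} = {}"
          using c x(4) i(2) iG by (auto simp: S_def Q_def)
        then show ?thesis by (simp only: card.empty)
      qed
    qed (use i xX in \<open>auto simp: \<A>_def\<close>)
  qed
  ultimately show ?thesis by blast
qed

section \<open>The step from \<open>Y\<close> to \<open>Pow Y\<close>\<close>

text \<open>Besides \<open>|Y|\<close> disjoint copies of the given system, there is one copy for every relation
  \<open>R\<close>, which attaches disjoint sets \<open>R `` {A}\<close> of at most \<open>2 * l\<close> old points to its members.
  Some \<open>R\<close> doubles \<open>l\<close> colours that occur \<open>|Y|\<close> times, so that \<open>n\<close> colours are left to be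
  defeated in the copy for \<open>R\<close>. If there are no such \<open>l\<close> colours, one of the disjoint copies
  meets only colours that occur \<open>|Y|\<close> times.\<close>

lemma exists_system_step:
  fixes Y :: "'b set" and K :: "'k set" and \<A> :: "'c set set"
  assumes Y: "infinite Y" and K: "infinite K"
    and sys: "bounded_system \<A> Y K (2 * l)" "defeats_colorings \<A> n"
    and l: "l \<le> n"
  shows "\<exists>\<B> :: ('b \<times> 'c + ('c set \<times> 'b \<times> 'c) set \<times> 'c) set set.
           bounded_system \<B> (Pow Y) K (2 * l) \<and> defeats_colorings \<B> (n + l)"
proof -
  define U where "U = \<Union>\<A>"
  define G where "G = Y \<times> U"
  \<comment> \<open>Coding attachments as subsets of \<open>\<A> \<times> G\<close> bounds their
    number by \<open>2 ^ |Y|\<close>. Disjointness of the attached sets keeps them from enlarging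
    intersections inside one copy.\<close>
  define \<R> where "\<R> = {R. R \<subseteq> \<A> \<times> G \<and> (\<forall>A. R `` {A} \<lesssim> {..<2 * l}) \<and>
      (\<forall>A B. A \<noteq> B \<longrightarrow> R `` {A} \<inter> R `` {B} = {})}"
  \<comment> \<open>\<open>Inl\<close> marks the old points, shared by all members;
    \<open>Inr\<close> marks the fresh ones, kept apart by their tag \<open>R\<close>.\<close>
  define C :: "'b \<Rightarrow> 'c set \<Rightarrow> ('b \<times> 'c + ('c set \<times> 'b \<times> 'c) set \<times> 'c) set"
    where "C i A = Inl ` ({i} \<times> A)" for i A
  define E :: "('c set \<times> 'b \<times> 'c) set \<Rightarrow> 'c set \<Rightarrow> ('b \<times> 'c + ('c set \<times> 'b \<times> 'c) set \<times> 'c) set"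
    where "E R A = Inl ` (R `` {A}) \<union> Inr ` ({R} \<times> A)" for R A
  define \<B> where "\<B> = (\<lambda>(i, A). C i A) ` (Y \<times> \<A>) \<union> (\<lambda>(R, A). E R A) ` (\<R> \<times> \<A>)"
  have \<A>: "\<A> \<lesssim> Y" "U \<lesssim> Y" "\<And>A. A \<in> \<A> \<Longrightarrow> A \<approx> K"
    "\<And>A B. A \<in> \<A> \<Longrightarrow> B \<in> \<A> \<Longrightarrow> A \<noteq> B \<Longrightarrow> A \<inter> B \<lesssim> {..<2 * l}"
    using sys(1) by (auto simp: bounded_system_def U_def)
  have G: "G \<lesssim> Y" unfolding G_def using Y \<A> by (intro times_lepoll_infinite) auto
  have YP: "Y \<lesssim> Pow Y" by (rule lepoll_Pow_self)
  have P: "infinite (Pow Y)" using Y by simp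
  have "Pow (\<A> \<times> G) \<lesssim> Pow Y"
    using Y \<A> G by (intro Pow_lepoll_mono times_lepoll_infinite) auto
  then have \<R>: "\<R> \<lesssim> Pow Y"
    by (rule lepoll_trans[OF subset_imp_lepoll, rotated]) (auto simp: \<R>_def)
  note le = lepoll_trans[OF \<A>(1) YP] lepoll_trans[OF \<A>(2) YP] lepoll_trans[OF G YP]
  have R_small: "R `` {A} \<lesssim> {..<2 * l}" if "R \<in> \<R>" for R A
    using that by (auto simp: \<R>_def)
  have C_eqpoll: "C i A \<approx> K" if "A \<in> \<A>" for i A
    unfolding C_def using \<A>(3)[OF that] times_singleton_eqpoll
    by (metis inj_on_image_eqpoll_self inj_Inl inj_on_subset subset_UNIV eqpoll_trans)
  have E_eqpoll: "E R A \<approx> K" if "A \<in> \<A>" "R \<in> \<R>" for R A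
  proof (rule lepoll_antisym)
    have iA: "Inr ` ({R} \<times> A) \<approx> K"
      using \<A>(3)[OF that(1)] times_singleton_eqpoll
      by (metis inj_on_image_eqpoll_self inj_Inr inj_on_subset subset_UNIV eqpoll_trans)
    have "finite (R `` {A})" using R_small[OF that(2)] by (auto simp: lepoll_iff_finite_card)
    then show "E R A \<lesssim> K" unfolding E_def using K iA
      by (intro Un_lepoll_infinite) (auto simp: finite_lepoll_infinite eqpoll_imp_lepoll)
    have "K \<lesssim> Inr ` ({R} \<times> A)" using iA eqpoll_sym eqpoll_imp_lepoll by blast
    then show "K \<lesssim> E R A"
      unfolding E_def by (rule lepoll_trans[OF _ subset_imp_lepoll[OF Un_upper2]])
  qed
  \<comment> \<open>This covers a member of the copy for \<open>R\<close> against any member outside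
    that copy: they share no fresh points, only attached ones.\<close>
  have old: "B \<inter> B' \<lesssim> {..<2 * l}" if "R \<in> \<R>" "B \<inter> B' \<subseteq> Inl ` (R `` {A})"
    for R A and B B' :: "('b \<times> 'c + ('c set \<times> 'b \<times> 'c) set \<times> 'c) set"
    using R_small[OF that(1)] subset_image_lepoll[OF that(2)] lepoll_trans by blast
  have CC: "C i A \<inter> C j B \<lesssim> {..<2 * l}" if "A \<in> \<A>" "B \<in> \<A>" "C i A \<noteq> C j B" for i j A B
  proof (cases "i = j")
    case True
    have "C i A \<inter> C j B \<subseteq> (\<lambda>x. Inl (i, x)) ` (A \<inter> B)" by (auto simp: C_def)
    moreover have "A \<inter> B \<lesssim> {..<2 * l}" using \<A>(4) that True by blast
    ultimately show ?thesis by (meson subset_image_lepoll lepoll_trans)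
  next
    case False
    then have "C i A \<inter> C j B = {}" by (auto simp: C_def)
    then show ?thesis by simp
  qed
  have EE: "E R A \<inter> E R' B \<lesssim> {..<2 * l}"
    if "A \<in> \<A>" "B \<in> \<A>" "R \<in> \<R>" "E R A \<noteq> E R' B" for R R' A B
  proof (cases "R = R'")
    case True
    then have "A \<noteq> B" using that by blast
    then have "R `` {A} \<inter> R `` {B} = {}" using that(3) by (auto simp: \<R>_def)
    then have "E R A \<inter> E R' B \<subseteq> (\<lambda>x. Inr (R, x)) ` (A \<inter> B)"
      using True by (auto simp: E_def)
    then show ?thesis using \<A>(4)[OF that(1,2) \<open>A \<noteq> B\<close>] by (meson subset_image_lepoll lepoll_trans)
  next
    case False
    then show ?thesis using that(3) by (intro old[of R _ _ A]) (auto simp: E_def)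
  qed
  have form: "(\<exists>i A. B = C i A \<and> A \<in> \<A>) \<or> (\<exists>R A. B = E R A \<and> R \<in> \<R> \<and> A \<in> \<A>)"
    if "B \<in> \<B>" for B
    using that unfolding \<B>_def by auto
  have "\<B> \<lesssim> Pow Y"
    unfolding \<B>_def using P YP \<R> le
    by (intro Un_lepoll_infinite lepoll_trans[OF image_lepoll] times_lepoll_infinite)
  moreover have "\<Union>\<B> \<lesssim> Pow Y"
  proof -
    have "\<Union>\<B> \<subseteq> G <+> (\<R> \<times> U)"
      by (auto simp: \<B>_def C_def E_def U_def G_def \<R>_def)
    moreover have "G <+> (\<R> \<times> U) \<lesssim> Pow Y"
      using P \<R> le by (intro Plus_lepoll_infinite times_lepoll_infinite)
    ultimately show ?thesis by (meson lepoll_trans subset_imp_lepoll)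
  qed
  moreover have "B \<approx> K" if "B \<in> \<B>" for B
    using form[OF that] C_eqpoll E_eqpoll by blast
  moreover have "B \<inter> B' \<lesssim> {..<2 * l}" if BB: "B \<in> \<B>" "B' \<in> \<B>" "B \<noteq> B'" for B B'
  proof -
    consider i A j A' where "B = C i A" "B' = C j A'" "A \<in> \<A>" "A' \<in> \<A>"
      | i A R A' where "B = C i A" "B' = E R A'" "R \<in> \<R>"
      | i A R A' where "B' = C i A" "B = E R A'" "R \<in> \<R>"
      | R A R' A' where "B = E R A" "B' = E R' A'" "R \<in> \<R>" "A \<in> \<A>" "A' \<in> \<A>"
      using form[OF BB(1)] form[OF BB(2)] by blast
    then show ?thesis
    proof cases
      case 1
      then show ?thesis using CC BB(3) by simp
    next
      case 2
      then show ?thesis by (intro old[of R B B' A']) (auto simp: C_def E_def)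
    next
      case 3
      then show ?thesis by (intro old[of R B B' A']) (auto simp: C_def E_def)
    next
      case 4
      then show ?thesis using EE BB(3) by simp
    qed
  qed
  ultimately have "bounded_system \<B> (Pow Y) K (2 * l)"
    by (auto simp: bounded_system_def)
  moreover have "defeats_colorings \<B> (n + l)"
    unfolding defeats_colorings_def
  proof (intro allI impI)
    fix f :: "'b \<times> 'c + ('c set \<times> 'b \<times> 'c) set \<times> 'c \<Rightarrow> nat" and T :: "nat set"
    assume T: "finite T" "card T \<le> n + l"
    define D where "D c = {z \<in> G. f (Inl z) = c}" for c
    define Tb where "Tb = {c \<in> T. Y \<lesssim> D c}"
    have "finite Tb" using T by (simp add: Tb_def)
    show "\<exists>A\<in>\<B>. \<forall>c\<in>T. card {z \<in> A. f z = c} \<noteq> 1"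
    proof (cases "card Tb < l")
      case True
      \<comment> \<open>The colours in \<open>T - Tb\<close> occupy fewer than \<open>|Y|\<close>
        old points altogether, so some copy \<open>i\<close> avoids them all. Only the colours in
        \<open>Tb\<close> remain there, fewer than \<open>l \<le> n\<close>.\<close>
      let ?W = "\<Union>c\<in>T - Tb. D c"
      have "D c \<prec> Y" if "c \<in> T - Tb" for c
      proof -
        have "D c \<lesssim> Y" using lepoll_trans[OF subset_imp_lepoll G, of "D c"] by (auto simp: D_def)
        then show ?thesis using that unfolding Tb_def lesspoll_def
          by (metis (no_types, lifting) DiffE eqpoll_imp_lepoll eqpoll_sym mem_Collect_eq)
      qed
      then have "?W \<prec> Y" using T Y by (intro finite_UN_lesspoll_infinite) auto
      then have "fst ` ?W \<prec> Y" by (rule lesspoll_trans1[OF image_lepoll])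
      then have "\<not> Y \<subseteq> fst ` ?W"
        by (meson lesspoll_not_refl lesspoll_trans1 subset_imp_lepoll)
      then obtain i where i: "i \<in> Y" "i \<notin> fst ` ?W" by auto
      obtain A where A: "A \<in> \<A>" "\<forall>c\<in>Tb. card {x \<in> A. f (Inl (i, x)) = c} \<noteq> 1"
        using defeats_coloringsD[OF sys(2) \<open>finite Tb\<close>, of "\<lambda>x. f (Inl (i, x))"] True l by auto
      have "card {z \<in> C i A. f z = c} \<noteq> 1" if "c \<in> T" for c
      proof -
        have CA: "C i A = (\<lambda>x. Inl (i, x)) ` A" by (auto simp: C_def)
        have eq: "card {z \<in> C i A. f z = c} = card {x \<in> A. f (Inl (i, x)) = c}"
          unfolding CA by (rule card_Collect_image_eq) (auto simp: inj_on_def)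
        show ?thesis
        proof (cases "c \<in> Tb")
          case False
          then have "\<And>x. x \<in> A \<Longrightarrow> f (Inl (i, x)) \<noteq> c"
            using i that A(1) by (force simp: D_def G_def U_def)
          then have "{x \<in> A. f (Inl (i, x)) = c} = {}" by blast
          then show ?thesis unfolding eq by (metis card.empty zero_neq_one)
        qed (use A eq in auto)
      qed
      then show ?thesis using i(1) A(1) by (intro bexI[of _ "C i A"]) (auto simp: \<B>_def)
    next
      case False
      then obtain S where S: "S \<subseteq> Tb" "card S = l" "finite S"
        by (metis obtain_subset_with_card_n not_less)
      \<comment> \<open>The factor \<open>bool\<close> reserves two points of each colour in
        \<open>S\<close> for every member of \<open>\<A>\<close>.\<close>
      have "\<A> \<times> (UNIV :: bool set) \<lesssim> Y"
        using Y \<A>(1) by (intro times_lepoll_infinite) (auto simp: finite_lepoll_infinite)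
      then have "\<A> \<times> (UNIV :: bool set) \<lesssim> D c" if "c \<in> S" for c
        using S(1) that lepoll_trans unfolding Tb_def by blast
      then obtain g where g: "\<And>c. c \<in> S \<Longrightarrow> inj_on (g c) (\<A> \<times> (UNIV :: bool set))"
          "\<And>c. c \<in> S \<Longrightarrow> g c ` (\<A> \<times> UNIV) \<subseteq> D c"
        unfolding lepoll_def by metis
      define R where "R = {(A, g c (A, b)) | A c b. A \<in> \<A> \<and> c \<in> S}"
      have gD: "g c (A, b) \<in> G" "f (Inl (g c (A, b))) = c" if "c \<in> S" "A \<in> \<A>" for c A b
        using g(2)[OF that(1)] that(2) by (auto simp: D_def)
      have g_inj: "A = A' \<and> b = b'"
        if "g c (A, b) = g c' (A', b')" "c \<in> S" "c' \<in> S" "A \<in> \<A>" "A' \<in> \<A>" for c c' A A' b b'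
      proof -
        \<comment> \<open>The point determines its colour, so sets reserved for different colours
          cannot collide.\<close>
        have "c = c'" using that gD by metis
        then have "(A, b) = (A', b')" using that by (intro inj_onD[OF g(1)[of c]]) auto
        then show ?thesis by simp
      qed
      have "R \<in> \<R>"
      proof -
        have "R \<subseteq> \<A> \<times> G" using gD by (auto simp: R_def)
        moreover have "R `` {A} \<lesssim> {..<2 * l}" for A
        proof -
          have "R `` {A} \<subseteq> (\<lambda>p. g (fst p) (A, snd p)) ` (S \<times> UNIV)"
            unfolding R_def by force
          then have "R `` {A} \<lesssim> S \<times> (UNIV :: bool set)" by (rule subset_image_lepoll)
          also have "\<dots> \<approx> {..<2 * l}"
            using S by (simp add: eqpoll_iff_finite_card card_cartesian_product mult.commute)
          finally show ?thesis .
        qed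
        moreover have "R `` {A} \<inter> R `` {B} = {}" if "A \<noteq> B" for A B
        proof (rule ccontr)
          assume "R `` {A} \<inter> R `` {B} \<noteq> {}"
          then obtain z where "(A, z) \<in> R" "(B, z) \<in> R" by blast
          then obtain c b c' b' where "A \<in> \<A>" "B \<in> \<A>" "c \<in> S" "c' \<in> S"
            "g c (A, b) = g c' (B, b')"
            unfolding R_def by blast
          then show False using g_inj[of c A b c' B b'] \<open>A \<noteq> B\<close> by blast
        qed
        ultimately show ?thesis by (auto simp: \<R>_def)
      qed
      have fin: "finite (T - S)" using T by simp
      \<comment> \<open>Doubling disposes of \<open>l\<close> of the at most \<open>n + l\<close>
        colours; the rest is left to the fresh copy of \<open>\<A>\<close> attached to
        \<open>R\<close>.\<close>
      have "card (T - S) \<le> n"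
        using T S by (simp add: card_Diff_subset Tb_def subset_iff)
      then obtain A where A: "A \<in> \<A>" "\<forall>c\<in>T - S. card {x \<in> A. f (Inr (R, x)) = c} \<noteq> 1"
        using defeats_coloringsD[OF sys(2) fin, of "\<lambda>x. f (Inr (R, x))"] by auto
      have "card {z \<in> E R A. f z = c} \<noteq> 1" if "c \<in> T" for c
      proof (cases "c \<in> S")
        case True
        then show ?thesis
          using gD[OF True A(1)] g_inj[OF _ True True A(1) A(1)] A(1)
          by (intro card_neq_1_if_two[of "Inl (g c (A, True))" _ "Inl (g c (A, False))"])
             (auto simp: E_def R_def)
      next
        case False
        \<comment> \<open>Attached points carry only colours of \<open>S\<close>, so they do not
          disturb the count of any other colour.\<close>
        have "{z \<in> E R A. f z = c} = {z \<in> (\<lambda>x. Inr (R, x)) ` A. f z = c}"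
          using gD False by (auto simp: E_def R_def)
        also have "card \<dots> = card {x \<in> A. f (Inr (R, x)) = c}"
          by (rule card_Collect_image_eq) (auto simp: inj_on_def)
        finally show ?thesis using A(2) False that by auto
      qed
      then show ?thesis using \<open>R \<in> \<R>\<close> A(1) by (intro bexI[of _ "E R A"]) (auto simp: \<B>_def)
    qed
  qed
  ultimately show ?thesis by blast
qed

section \<open>Iteration along the beth sequence\<close>

text \<open>Each stage gains \<open>l\<close> colours. The step changes the type of points, so the
  system is moved back into \<open>L\<close> every time; \<open>K \<lesssim> L\<close> is carried
  along because the padding requires it.\<close>

lemma exists_system_beth:
  fixes K :: "'a set" and L :: "'b set"
  assumes "infinite K" "is_beth m K L"
  shows "K \<lesssim> L \<and> (\<exists>\<A> :: 'b set set. \<A> \<approx> L \<and> bounded_system \<A> L K (2 * l)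
           \<and> defeats_colorings \<A> ((m + 1) * l))"
  using assms(2)
proof (induction m arbitrary: L)
  case 0
  then have L: "L \<approx> K" by (auto simp: is_beth_def)
  then have KL: "K \<lesssim> L" using eqpoll_sym eqpoll_imp_lepoll by blast
  then have inf: "infinite L" using assms(1) infinite_lepoll by blast
  have "K \<noteq> {}" using assms(1) by auto
  obtain \<A> :: "('a \<times> nat) set set"
    where "bounded_system \<A> K K (2 * l)" and d: "defeats_colorings \<A> l"
    using exists_system_base[OF assms(1)] by blast
  then have "bounded_system \<A> L K (2 * l)"
    using KL by (auto simp: bounded_system_def intro: lepoll_trans)
  then obtain \<B> :: "'b set set"
    where "\<B> \<approx> L" "bounded_system \<B> L K (2 * l)" "defeats_colorings \<B> l"
    using bounded_system_transfer[OF _ d inf KL \<open>K \<noteq> {}\<close>] by blast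
  then show ?case using KL by auto
next
  case (Suc m)
  then obtain C where C: "C 0 \<approx> K" "\<forall>i<Suc m. C (Suc i) \<approx> Pow (C i)" "C (Suc m) = L"
    by (auto simp: is_beth_def)
  define Y where "Y = C m"
  have "is_beth m K Y" unfolding is_beth_def Y_def using C by (intro exI[of _ C]) auto
  with Suc.IH obtain \<A> :: "'b set set" where IH: "K \<lesssim> Y"
    "bounded_system \<A> Y K (2 * l)" "defeats_colorings \<A> ((m + 1) * l)"
    by blast
  have L: "Pow Y \<lesssim> L" using C unfolding Y_def by (metis eqpoll_imp_lepoll eqpoll_sym lessI)
  have "infinite Y" using IH(1) assms(1) infinite_lepoll by blast
  then obtain \<B> :: "('b \<times> 'b + ('b set \<times> 'b \<times> 'b) set \<times> 'b) set set"
    where B: "bounded_system \<B> (Pow Y) K (2 * l)"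
      and "defeats_colorings \<B> ((m + 1) * l + l)"
    using exists_system_step[OF _ assms(1) IH(2,3)] by auto
  then have d: "defeats_colorings \<B> ((Suc m + 1) * l)"
    by (simp add: algebra_simps)
  have KL: "K \<lesssim> L" using IH(1) L lepoll_Pow_self lepoll_trans by metis
  then have inf: "infinite L" using assms(1) infinite_lepoll by blast
  have "K \<noteq> {}" using assms(1) by auto
  have "bounded_system \<B> L K (2 * l)"
    using B L by (auto simp: bounded_system_def intro: lepoll_trans)
  then show ?case using bounded_system_transfer[OF _ d inf KL \<open>K \<noteq> {}\<close>] KL by metis
qed

theorem theorem6p4:
  fixes K :: "'a set" and L :: "'b set" and m l :: nat
  assumes "infinite K" and "is_beth m K L" and "l > 0"
  shows "\<exists>\<A> :: 'b set set. is_system \<A> L K {..<2 * l + 1}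
           \<and> wchi_CF_ge \<A> ((m + 1) * l + 1)"
proof -
  obtain \<A> :: "'b set set" where \<A>: "\<A> \<approx> L" "bounded_system \<A> L K (2 * l)"
    "defeats_colorings \<A> ((m + 1) * l)"
    using exists_system_beth[OF assms(1,2)] by blast
  \<comment> \<open>At most \<open>2 * l\<close> common points means fewer than
    \<open>2 * l + 1\<close>.\<close>
  have "is_system \<A> L K {..<2 * l + 1}"
    using \<A>(1,2)
    unfolding is_system_def bounded_system_def lepoll_iff_finite_card lesspoll_iff_finite_card
    by (metis less_Suc_eq_le Suc_eq_plus1)
  then show ?thesis using \<A>(3) defeats_colorings_imp_wchi_CF_ge by blast
qed

end
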